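(* Let $f:[a,b]\times\mathbb R\to\mathbb R$ be continuous and Lipschitz continuous in its second argument, i.e. there is a constant $L$ with $|f(t,u_1)-f(t,u_2)|\le L|u_1-u_2|$ for all $t\in[a,b]$, $u_1,u_2\in\mathbb R$, and let $u$ be the solution of $u'=f(t,u)$ on $[a,b]$, $u(a)=u_0$. Let $a_{21},a_{31},a_{32},b_1,b_2,b_3,c_2,c_3$ be real coefficients satisfying $$b_1+b_2+b_3=1,\qquad a_{21}=c_2,\qquad a_{31}+a_{32}=c_3,$$ $$b_2c_2+b_3c_3=\tfrac12,\qquad b_2c_2^2+b_3c_3^2=\tfrac13,\qquad a_{32}b_3c_2=\tfrac16.$$ Suppose that the squared shape parameters $\epsilon_{n2}^2,\epsilon_{n3}^2\in\mathbb R$ are bounded for all $n=0,1,\dots,N-1$ (by a bound independent of $n$ and of $h$). Then the three-stage RBF Runge-Kutta method defined in the context converges: with $h=(b-a)/N$, $v_N\to u(b)$ as $h\to0$ (equivalently $N\to\infty$).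
   Context: For $N\ge1$ let $h=(b-a)/N$ and $t_n=a+nh$, $n=0,\dots,N$. The three-stage RBF Runge-Kutta method with squared shape parameters $\epsilon_{n2}^2,\epsilon_{n3}^2\in\mathbb R$ (the shape parameters are real or purely imaginary; they may vary with $n$ and $h$) produces $v_0=u_0$ and, for $n=0,\dots,N-1$, $$v_{n+1}=v_n+h(b_1k_1+b_2k_2+b_3k_3),\quad k_1=f(t_n,v_n),$$ $$k_2=f\big(t_n+c_2h,\;v_ne^{-\epsilon_{n2}^2(c_2h)^2}+h\,a_{21}k_1\big),\quad k_3=f\big(t_n+c_3h,\;v_ne^{-\epsilon_{n3}^2(c_3h)^2}+h(a_{31}k_1+a_{32}k_2)\big).$$ It is understood that $f$ is defined (and has the stated properties) at all the arguments occurring in the method. *)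

theory Defs
  imports "HOL-Analysis.Analysis"
begin

text \<open>
  The arguments \<open>e2\<close> and \<open>e3\<close> below are the \<^emph>\<open>squared\<close> shape parameters.  They range over all
  real numbers, a negative value corresponding to a purely imaginary shape parameter.
\<close>

definition rbf_rk3_step ::
  "(real \<Rightarrow> real \<Rightarrow> real) \<Rightarrow> real \<Rightarrow> real \<Rightarrow> real \<Rightarrow> real \<Rightarrow> real \<Rightarrow> real \<Rightarrow> real \<Rightarrow> real
    \<Rightarrow> real \<Rightarrow> real \<Rightarrow> real \<Rightarrow> real \<Rightarrow> real \<Rightarrow> real"
where
  "rbf_rk3_step f a21 a31 a32 b1 b2 b3 c2 c3 e2 e3 h t v =
    (let k1 = f t v;
         k2 = f (t + c2 * h) (v * exp (- (e2 * (c2 * h)\<^sup>2)) + h * (a21 * k1));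
         k3 = f (t + c3 * h) (v * exp (- (e3 * (c3 * h)\<^sup>2)) + h * (a31 * k1 + a32 * k2))
     in v + h * (b1 * k1 + b2 * k2 + b3 * k3))"

definition step_size :: "real \<Rightarrow> real \<Rightarrow> nat \<Rightarrow> real" where
  "step_size a b N = (b - a) / real N"

definition grid_point :: "real \<Rightarrow> real \<Rightarrow> nat \<Rightarrow> nat \<Rightarrow> real" where
  "grid_point a b N n = a + real n * step_size a b N"

text \<open>
  \<open>rbf_rk3 \<dots> N n\<close> is $v_n$ computed with $N$ steps on $[a,b]$; only \<open>n \<le> N\<close> and \<open>N \<ge> 1\<close> are
  meaningful.  The squared shape parameters \<open>e2 N n\<close> and \<open>e3 N n\<close> used in step \<open>n\<close> may depend on
  \<open>N\<close>, that is, on the step size.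
\<close>

primrec rbf_rk3 ::
  "(real \<Rightarrow> real \<Rightarrow> real) \<Rightarrow> real \<Rightarrow> real \<Rightarrow> real \<Rightarrow> real \<Rightarrow> real \<Rightarrow> real \<Rightarrow> real \<Rightarrow> real
    \<Rightarrow> (nat \<Rightarrow> nat \<Rightarrow> real) \<Rightarrow> (nat \<Rightarrow> nat \<Rightarrow> real) \<Rightarrow> real \<Rightarrow> real \<Rightarrow> real \<Rightarrow> nat \<Rightarrow> nat \<Rightarrow> real"
where
  "rbf_rk3 f a21 a31 a32 b1 b2 b3 c2 c3 e2 e3 a b u0 N 0 = u0"
| "rbf_rk3 f a21 a31 a32 b1 b2 b3 c2 c3 e2 e3 a b u0 N (Suc n) =
    rbf_rk3_step f a21 a31 a32 b1 b2 b3 c2 c3 (e2 N n) (e3 N n)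
      (step_size a b N) (grid_point a b N n)
      (rbf_rk3 f a21 a31 a32 b1 b2 b3 c2 c3 e2 e3 a b u0 N n)"

text \<open>
  If $c_2$ or $c_3$ lies outside $[0,1]$, the method may evaluate the right-hand side at times
  outside $[a,b]$.  A set \<open>D\<close> is admissible as the time domain of the right-hand side if it
  contains $[a,b]$ and all times at which the method evaluates it, for every number of steps.
  For $c_2, c_3 \in [0,1]$ the interval $[a,b]$ itself is admissible.
\<close>

definition admissible_times :: "real \<Rightarrow> real \<Rightarrow> real \<Rightarrow> real \<Rightarrow> real set \<Rightarrow> bool" where
  "admissible_times a b c2 c3 D \<longleftrightarrow>
    {a..b} \<subseteq> D \<and>
    (\<forall>N\<ge>1. \<forall>n<N. grid_point a b N n + c2 * step_size a b N \<in> D \<and>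
                 grid_point a b N n + c3 * step_size a b N \<in> D)"

end

theory Submission
  imports Defs
begin

text \<open>
  The method is a one-step method, and convergence follows from consistency and stability.

  Stability: the step map is Lipschitz in \<open>v\<close> with constant \<open>1 + K h\<close>, because every stage is
  Lipschitz in \<open>v\<close> and the leading term \<open>v\<close> of the update is not damped; the factors
  $e^{-\epsilon^2 (c h)^2}$ inside the stages only have to stay bounded, which they do for bounded
  squared shape parameters, of either sign (\<open>rbf_rk3_step_stability\<close>).

  Consistency: as \<open>f\<close> is merely continuous, \<open>u\<close> is merely $C^1$ and a higher Taylor expansion has no
  meaning; a defect of size \<open>o(h)\<close>, uniformly in \<open>t\<close>, is what can be had and what suffices
  (\<open>rbf_rk3_step_consistency\<close>).  The damping factors are \<open>1 + O(h\<^sup>2)\<close>, so all stage arguments lie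
  within \<open>O(h)\<close> of the point \<open>(t, u t)\<close>, and all stages are close to \<open>f t (u t)\<close>.  By the mean value
  theorem the increment of \<open>u\<close> is \<open>h\<close> times a slope that is close to \<open>f t (u t)\<close> too, and
  \<open>b1 + b2 + b3 = 1\<close> makes the main terms cancel.  Stage times may leave \<open>[a,b]\<close>, and
  \<open>D\<close> may fail to be closed; closeness is therefore measured from the compact graph of \<open>u\<close> by
  \<open>continuous_on_uniform_near_compact\<close>, which allows the second point to range over
  all of \<open>D \<times> UNIV\<close>.

  A discrete Gronwall estimate (\<open>one_step_error_bound\<close>) turns defects \<open>\<le> \<epsilon> h\<close> into a global error
  \<open>\<le> \<epsilon> (b - a) exp (K (b - a))\<close>.
\<close>

section \<open>Tools\<close>

text \<open>
  Uniform continuity on \<open>C\<close> would confine \<open>q\<close> to \<open>C\<close>; here only \<open>p\<close> is confined.  The balls on which \<open>f\<close>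
  varies by less than \<open>e / 2\<close> from its value at the centre, one for each centre in \<open>C\<close>, cover \<open>C\<close>,
  and \<open>d\<close> is a Lebesgue number of that cover.
\<close>
lemma continuous_on_uniform_near_compact:
  fixes f :: "'a::metric_space \<Rightarrow> 'b::metric_space"
  assumes cont: "continuous_on S f" and "compact C" "C \<subseteq> S" and e: "e > 0"
  obtains d where "d > 0"
    and "\<And>p q. p \<in> C \<Longrightarrow> q \<in> S \<Longrightarrow> dist p q < d \<Longrightarrow> dist (f p) (f q) < e"
proof -
  have "\<exists>r>0. \<forall>q\<in>S. dist q p < r \<longrightarrow> dist (f q) (f p) < e / 2" if "p \<in> C" for p
    using cont that \<open>C \<subseteq> S\<close> e unfolding continuous_on_iff
    by (meson half_gt_zero subsetD)
  then obtain r where r: "\<And>p. p \<in> C \<Longrightarrow> r p > 0"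
    "\<And>p q. p \<in> C \<Longrightarrow> q \<in> S \<Longrightarrow> dist q p < r p \<Longrightarrow> dist (f q) (f p) < e / 2"
    by metis
  have "C \<subseteq> \<Union> ((\<lambda>p. ball p (r p)) ` C)"
    using r(1) by force
  then obtain d where "0 < d"
    and d: "\<And>x. x \<in> C \<Longrightarrow> \<exists>G \<in> (\<lambda>p. ball p (r p)) ` C. ball x d \<subseteq> G"
    by (rule Heine_Borel_lemma[OF \<open>compact C\<close>]) auto
  show thesis
  proof (rule that[OF \<open>0 < d\<close>])
    fix p q assume "p \<in> C" "q \<in> S" "dist p q < d"
    then obtain c where "c \<in> C" "ball p d \<subseteq> ball c (r c)"
      using d by blast
    moreover have "p \<in> ball p d" "q \<in> ball p d"
      using \<open>0 < d\<close> \<open>dist p q < d\<close> by auto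
    ultimately have "p \<in> ball c (r c)" "q \<in> ball c (r c)"
      by blast+
    then have "dist p c < r c" "dist q c < r c"
      by (simp_all add: dist_commute)
    then have "dist (f p) (f c) < e / 2" "dist (f q) (f c) < e / 2"
      using r(2) \<open>c \<in> C\<close> \<open>p \<in> C\<close> \<open>q \<in> S\<close> \<open>C \<subseteq> S\<close> by auto
    then show "dist (f p) (f q) < e"
      by (rule dist_triangle_half_l)
  qed
qed

text \<open>
  The induction carries the bound \<open>n \<epsilon> h (1 + K h)^n\<close>: the defect of each step is
  amplified by at most \<open>n\<close> later steps.
\<close>
lemma one_step_error_bound:
  fixes E :: "nat \<Rightarrow> real"
  assumes "E 0 = 0" and "0 \<le> h" "0 \<le> K" "0 \<le> \<epsilon>"
    and step: "\<And>n. n < N \<Longrightarrow> E (Suc n) \<le> (1 + h * K) * E n + h * \<epsilon>"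
  shows "E N \<le> \<epsilon> * (real N * h) * exp (K * (real N * h))"
proof -
  have hK: "1 \<le> 1 + h * K"
    using assms by simp
  have "E n \<le> real n * h * \<epsilon> * (1 + h * K) ^ n" if "n \<le> N" for n
    using that
  proof (induction n)
    case 0
    then show ?case using \<open>E 0 = 0\<close> by simp
  next
    case (Suc n)
    have "E (Suc n) \<le> (1 + h * K) * E n + h * \<epsilon>"
      using step Suc.prems by simp
    also have "\<dots> \<le> (1 + h * K) * (real n * h * \<epsilon> * (1 + h * K) ^ n) + h * \<epsilon> * (1 + h * K) ^ Suc n"
    proof (rule add_mono)
      show "(1 + h * K) * E n \<le> (1 + h * K) * (real n * h * \<epsilon> * (1 + h * K) ^ n)"
        using Suc hK by (intro mult_left_mono) auto
      show "h * \<epsilon> \<le> h * \<epsilon> * (1 + h * K) ^ Suc n"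
        using one_le_power[OF hK, of "Suc n"] assms
        by (metis mult.right_neutral mult_left_mono mult_nonneg_nonneg)
    qed
    also have "\<dots> = real (Suc n) * h * \<epsilon> * (1 + h * K) ^ Suc n"
      by (simp add: algebra_simps)
    finally show ?case .
  qed
  then have "E N \<le> real N * h * \<epsilon> * (1 + h * K) ^ N"
    by simp
  also have "\<dots> \<le> real N * h * \<epsilon> * exp (h * K) ^ N"
    using assms by (intro mult_left_mono power_mono) auto
  also have "exp (h * K) ^ N = exp (K * (real N * h))"
    by (simp add: exp_of_nat_mult[symmetric] ac_simps)
  finally show ?thesis
    by (simp add: ac_simps)
qed

text \<open>
  A negative squared shape parameter makes the factor exceed 1, whence the two-sided bound.
\<close>
lemma damping_factor_minus_1_le:
  fixes e M c h :: real
  assumes "\<bar>e\<bar> \<le> M"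
  shows "\<bar>exp (- (e * (c * h)\<^sup>2)) - 1\<bar> \<le> exp (M * (c * h)\<^sup>2) - 1"
proof -
  define y Y where "y = e * (c * h)\<^sup>2" and "Y = M * (c * h)\<^sup>2"
  have "\<bar>y\<bar> \<le> Y"
    using assms unfolding y_def Y_def by (simp add: abs_mult mult_right_mono)
  then have y: "exp (- y) \<le> exp Y" "exp (- Y) \<le> exp (- y)" by auto
  \<comment> \<open>The lower bound holds because the average of \<open>exp Y\<close> and \<open>exp (- Y)\<close> is at least 1.\<close>
  have "1 + Y \<le> exp Y" "1 + (- Y) \<le> exp (- Y)"
    by (rule exp_ge_add_one_self)+
  with y show ?thesis
    unfolding y_def[symmetric] Y_def[symmetric] by linarith
qed

section \<open>Stability\<close>

text \<open>
  The bound \<open>h \<le> 1\<close> on the step size is what makes \<open>K\<close> uniform: it turns the damping factor of a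
  stage into a quantity of size at most \<open>exp (\<bar>M\<bar> * c\<^sup>2)\<close> and absorbs the powers of \<open>h\<close> that
  accumulate when a stage uses the preceding ones.
\<close>
lemma rbf_rk3_step_stability:
  fixes f :: "real \<Rightarrow> real \<Rightarrow> real"
  assumes "0 \<le> L"
  shows "\<exists>K\<ge>0. \<forall>h t v w e2 e3.
      0 \<le> h \<and> h \<le> 1 \<and> \<bar>e2\<bar> \<le> M \<and> \<bar>e3\<bar> \<le> M \<and>
      (\<forall>s\<in>{t, t + c2 * h, t + c3 * h}. \<forall>x y. \<bar>f s x - f s y\<bar> \<le> L * \<bar>x - y\<bar>) \<longrightarrow>
      \<bar>rbf_rk3_step f a21 a31 a32 b1 b2 b3 c2 c3 e2 e3 h t v -
       rbf_rk3_step f a21 a31 a32 b1 b2 b3 c2 c3 e2 e3 h t w\<bar> \<le> (1 + h * K) * \<bar>v - w\<bar>"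
proof -
  \<comment> \<open>\<open>K2\<close> and \<open>K3\<close> are Lipschitz constants of the second and third stage.\<close>
  define K2 where "K2 = L * (exp (\<bar>M\<bar> * c2\<^sup>2) + \<bar>a21\<bar> * L)"
  define K3 where "K3 = L * (exp (\<bar>M\<bar> * c3\<^sup>2) + (\<bar>a31\<bar> * L + \<bar>a32\<bar> * K2))"
  define K where "K = \<bar>b1\<bar> * L + \<bar>b2\<bar> * K2 + \<bar>b3\<bar> * K3"
  have K2: "0 \<le> K2" and K3: "0 \<le> K3"
    unfolding K2_def K3_def using assms by auto
  have K: "0 \<le> K"
    unfolding K_def using assms K2 K3 by auto
  have damp: "exp (- (e * (c * h)\<^sup>2)) \<le> exp (\<bar>M\<bar> * c\<^sup>2)"
    if "\<bar>e\<bar> \<le> M" "0 \<le> h" "h \<le> 1" for e c h :: real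
  proof -
    have "- (e * (c * h)\<^sup>2) \<le> \<bar>M\<bar> * (c * h)\<^sup>2"
      using that by (smt (verit) mult_minus_left mult_right_mono zero_le_power2)
    also have "\<dots> \<le> \<bar>M\<bar> * c\<^sup>2"
      using that by (intro mult_left_mono) (auto simp: power_mult_distrib mult_left_le power_le_one)
    finally show ?thesis by simp
  qed
  have stage: "\<bar>(v * E + h * p) - (w * E + h * q)\<bar> \<le> (B + P) * \<bar>v - w\<bar>"
    if "0 \<le> E" "E \<le> B" "0 \<le> h" "h \<le> 1" "\<bar>p - q\<bar> \<le> P * \<bar>v - w\<bar>"
    for v w E h p q B P :: real
  proof -
    have "(v * E + h * p) - (w * E + h * q) = E * (v - w) + h * (p - q)"
      by (simp add: algebra_simps)
    also have "\<bar>\<dots>\<bar> \<le> E * \<bar>v - w\<bar> + h * \<bar>p - q\<bar>"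
      using that by (metis abs_mult abs_of_nonneg abs_triangle_ineq)
    also have "\<dots> \<le> B * \<bar>v - w\<bar> + 1 * \<bar>p - q\<bar>"
      using that by (intro add_mono mult_right_mono) auto
    also have "\<dots> \<le> (B + P) * \<bar>v - w\<bar>"
      using that by (simp add: algebra_simps)
    finally show ?thesis .
  qed
  have lin: "\<bar>x * y\<bar> \<le> (\<bar>x\<bar> * c) * d" if "\<bar>y\<bar> \<le> c * d" for x y c d :: real
    using that by (metis abs_ge_zero abs_mult mult.assoc mult_left_mono)
  show ?thesis
  proof (intro exI[of _ K] conjI K allI impI, elim conjE)
    fix h t v w e2 e3 :: real
    assume h: "0 \<le> h" "h \<le> 1" and e: "\<bar>e2\<bar> \<le> M" "\<bar>e3\<bar> \<le> M"
      and *: "\<forall>s\<in>{t, t + c2 * h, t + c3 * h}. \<forall>x y. \<bar>f s x - f s y\<bar> \<le> L * \<bar>x - y\<bar>"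
    have lip: "\<bar>f s x - f s y\<bar> \<le> L * \<bar>x - y\<bar>" if "s \<in> {t, t + c2 * h, t + c3 * h}" for s x y
      using * that by blast
    define k1 where "k1 x = f t x" for x
    define g2 where "g2 x = x * exp (- (e2 * (c2 * h)\<^sup>2)) + h * (a21 * k1 x)" for x
    define k2 where "k2 x = f (t + c2 * h) (g2 x)" for x
    define g3 where "g3 x = x * exp (- (e3 * (c3 * h)\<^sup>2)) + h * (a31 * k1 x + a32 * k2 x)" for x
    define k3 where "k3 x = f (t + c3 * h) (g3 x)" for x
    have step: "rbf_rk3_step f a21 a31 a32 b1 b2 b3 c2 c3 e2 e3 h t x =
        x + h * (b1 * k1 x + b2 * k2 x + b3 * k3 x)" for x
      by (simp add: rbf_rk3_step_def Let_def k1_def k2_def k3_def g2_def g3_def)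
    have d1: "\<bar>k1 v - k1 w\<bar> \<le> L * \<bar>v - w\<bar>"
      unfolding k1_def by (rule lip) simp
    have "\<bar>g2 v - g2 w\<bar> \<le> (exp (\<bar>M\<bar> * c2\<^sup>2) + \<bar>a21\<bar> * L) * \<bar>v - w\<bar>"
      unfolding g2_def using lin[OF d1, of a21]
      by (intro stage damp e h) (auto simp: right_diff_distrib)
    then have d2: "\<bar>k2 v - k2 w\<bar> \<le> K2 * \<bar>v - w\<bar>"
      unfolding k2_def K2_def using lip[of "t + c2 * h" "g2 v" "g2 w"] assms
      by (smt (verit) insertCI mult.assoc mult_left_mono)
    have "\<bar>(a31 * k1 v + a32 * k2 v) - (a31 * k1 w + a32 * k2 w)\<bar>
        \<le> (\<bar>a31\<bar> * L + \<bar>a32\<bar> * K2) * \<bar>v - w\<bar>"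
      using lin[OF d1, of a31] lin[OF d2, of a32]
      unfolding distrib_right right_diff_distrib by linarith
    then have "\<bar>g3 v - g3 w\<bar> \<le> (exp (\<bar>M\<bar> * c3\<^sup>2) + (\<bar>a31\<bar> * L + \<bar>a32\<bar> * K2)) * \<bar>v - w\<bar>"
      unfolding g3_def by (intro stage damp e h) auto
    then have d3: "\<bar>k3 v - k3 w\<bar> \<le> K3 * \<bar>v - w\<bar>"
      unfolding k3_def K3_def using lip[of "t + c3 * h" "g3 v" "g3 w"] assms
      by (smt (verit) insertCI mult.assoc mult_left_mono)
    have "\<bar>b1 * (k1 v - k1 w) + b2 * (k2 v - k2 w) + b3 * (k3 v - k3 w)\<bar> \<le> K * \<bar>v - w\<bar>"
      using lin[OF d1, of b1] lin[OF d2, of b2] lin[OF d3, of b3]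
      unfolding K_def distrib_right by linarith
    then have "h * \<bar>b1 * (k1 v - k1 w) + b2 * (k2 v - k2 w) + b3 * (k3 v - k3 w)\<bar>
        \<le> h * (K * \<bar>v - w\<bar>)"
      using h(1) by (rule mult_left_mono)
    moreover have "rbf_rk3_step f a21 a31 a32 b1 b2 b3 c2 c3 e2 e3 h t v -
       rbf_rk3_step f a21 a31 a32 b1 b2 b3 c2 c3 e2 e3 h t w =
       (v - w) + h * (b1 * (k1 v - k1 w) + b2 * (k2 v - k2 w) + b3 * (k3 v - k3 w))"
      unfolding step by (simp add: algebra_simps)
    moreover have "\<bar>h * (b1 * (k1 v - k1 w) + b2 * (k2 v - k2 w) + b3 * (k3 v - k3 w))\<bar>
        = h * \<bar>b1 * (k1 v - k1 w) + b2 * (k2 v - k2 w) + b3 * (k3 v - k3 w)\<bar>"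
      using h(1) by (simp add: abs_mult)
    ultimately show "\<bar>rbf_rk3_step f a21 a31 a32 b1 b2 b3 c2 c3 e2 e3 h t v -
       rbf_rk3_step f a21 a31 a32 b1 b2 b3 c2 c3 e2 e3 h t w\<bar> \<le> (1 + h * K) * \<bar>v - w\<bar>"
      unfolding distrib_right mult_1 mult.assoc
      by (smt (verit, best) abs_triangle_ineq)
  qed
qed

section \<open>Consistency\<close>

text \<open>
  The three summands come from the time offset, the damping factor and the slope \<open>p\<close>.  What
  matters is that their sum is free of \<open>t\<close>, \<open>x\<close> and \<open>e\<close> and tends to 0 with \<open>h\<close>.
\<close>
lemma stage_argument_dist_le:
  fixes t x :: real
  assumes "0 \<le> h" "\<bar>e\<bar> \<le> M" "\<bar>x\<bar> \<le> U" "\<bar>p\<bar> \<le> P"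
  shows "dist (t, x) (t + c * h, x * exp (- (e * (c * h)\<^sup>2)) + h * p)
    \<le> \<bar>c * h\<bar> + U * (exp (M * (c * h)\<^sup>2) - 1) + h * P"
proof -
  define q where "q = exp (- (e * (c * h)\<^sup>2)) - 1"
  have q: "\<bar>q\<bar> \<le> exp (M * (c * h)\<^sup>2) - 1"
    unfolding q_def by (rule damping_factor_minus_1_le[OF assms(2)])
  have "dist (t, x) (t + c * h, x * exp (- (e * (c * h)\<^sup>2)) + h * p)
      \<le> \<bar>c * h\<bar> + \<bar>x * q + h * p\<bar>"
    unfolding dist_Pair_Pair
    by (rule order.trans[OF sqrt_sum_squares_le_sum_abs])
      (simp add: dist_real_def q_def right_diff_distrib abs_minus_commute add.commute
        add_diff_eq diff_add_eq)
  also have "\<bar>x * q + h * p\<bar> \<le> \<bar>x\<bar> * \<bar>q\<bar> + h * \<bar>p\<bar>"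
    using \<open>0 \<le> h\<close> by (metis abs_mult abs_of_nonneg abs_triangle_ineq)
  also have "\<bar>x\<bar> * \<bar>q\<bar> + h * \<bar>p\<bar> \<le> U * (exp (M * (c * h)\<^sup>2) - 1) + h * P"
    using assms q by (intro add_mono mult_mono) auto
  finally show ?thesis by simp
qed

text \<open>
  Bounding a stage needs the bound of the preceding ones.  There is no circularity: once \<open>k1\<close>
  is bounded, the second stage argument is close to the graph of \<open>u\<close>, so \<open>k2\<close> is close to the
  slope and hence bounded, and the third stage follows in the same way.
\<close>
lemma rbf_rk3_step_consistency:
  fixes f :: "real \<Rightarrow> real \<Rightarrow> real" and u :: "real \<Rightarrow> real"
  assumes D: "{a..b} \<subseteq> D"
    and cont: "continuous_on (D \<times> UNIV) (\<lambda>(t, x). f t x)"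
    and deriv: "\<And>t. t \<in> {a..b} \<Longrightarrow> (u has_real_derivative f t (u t)) (at t within {a..b})"
    and b: "b1 + b2 + b3 = 1"
    and "0 < \<epsilon>"
  shows "\<forall>\<^sub>F h in at_right 0. \<forall>t e2 e3.
      t \<in> {a..b} \<and> t + h \<in> {a..b} \<and> t + c2 * h \<in> D \<and> t + c3 * h \<in> D \<and> \<bar>e2\<bar> \<le> M \<and> \<bar>e3\<bar> \<le> M \<longrightarrow>
      \<bar>rbf_rk3_step f a21 a31 a32 b1 b2 b3 c2 c3 e2 e3 h t (u t) - u (t + h)\<bar> \<le> h * \<epsilon>"
proof -
  have cont_u: "continuous_on {a..b} u"
    using deriv by (rule DERIV_continuous_on)
  have cont_g: "continuous_on {a..b} (\<lambda>t. (t, u t))"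
    by (intro continuous_intros cont_u)
  have cont_F: "continuous_on {a..b} (\<lambda>t. f t (u t))"
    using continuous_on_compose2[OF cont cont_g] D by auto
  obtain U where U: "\<And>t. t \<in> {a..b} \<Longrightarrow> \<bar>u t\<bar> \<le> U"
    using compact_imp_bounded[OF compact_continuous_image[OF cont_u compact_Icc]]
    unfolding bounded_real by blast
  obtain B where B: "\<And>t. t \<in> {a..b} \<Longrightarrow> \<bar>f t (u t)\<bar> \<le> B"
    using compact_imp_bounded[OF compact_continuous_image[OF cont_F compact_Icc]]
    unfolding bounded_real by blast
  \<comment> \<open>In the end the tolerance \<open>\<eta>\<close> enters once for the slope of \<open>u\<close> and with weight
      \<open>\<bar>b1\<bar> + \<bar>b2\<bar> + \<bar>b3\<bar>\<close> for the stages.\<close>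
  define \<eta> where "\<eta> = \<epsilon> / (1 + \<bar>b1\<bar> + \<bar>b2\<bar> + \<bar>b3\<bar>)"
  have \<eta>: "0 < \<eta>" "\<eta> * (1 + \<bar>b1\<bar> + \<bar>b2\<bar> + \<bar>b3\<bar>) = \<epsilon>"
    unfolding \<eta>_def using \<open>0 < \<epsilon>\<close> by (auto intro!: divide_pos_pos simp: add_pos_nonneg)
  obtain d where "0 < d" and d: "\<And>p q. p \<in> (\<lambda>t. (t, u t)) ` {a..b} \<Longrightarrow> q \<in> D \<times> UNIV \<Longrightarrow>
      dist p q < d \<Longrightarrow> dist (case p of (t, x) \<Rightarrow> f t x) (case q of (t, x) \<Rightarrow> f t x) < \<eta>"
    using continuous_on_uniform_near_compact[OF cont compact_continuous_image[OF cont_g] _ \<eta>(1)] D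
    by (smt (verit) UNIV_I compact_Icc image_subset_iff mem_Sigma_iff subsetD)
  have near: "\<bar>f s x - f t (u t)\<bar> < \<eta>"
    if "t \<in> {a..b}" "s \<in> D" "dist (t, u t) (s, x) < d" for s t x
    using d[of "(t, u t)" "(s, x)"] that by (auto simp: dist_real_def abs_minus_commute)
  define r where "r c P h = \<bar>c * h\<bar> + U * (exp (M * (c * h)\<^sup>2) - 1) + h * P" for c P h :: real
  \<comment> \<open>Slope bounds entering the stages; \<open>B + \<eta>\<close> bounds \<open>k2\<close>.\<close>
  define P2 where "P2 = \<bar>a21\<bar> * B"
  define P3 where "P3 = \<bar>a31\<bar> * B + \<bar>a32\<bar> * (B + \<eta>)"
  have small_r: "\<forall>\<^sub>F h in at_right 0. r c P h < d" for c P
  proof -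
    have "((\<lambda>h. r c P h) \<longlongrightarrow> r c P 0) (at_right 0)"
      unfolding r_def by (intro tendsto_intros)
    then show ?thesis
      using \<open>0 < d\<close> by (intro order_tendstoD(2)) (auto simp: r_def)
  qed
  have small_u: "\<forall>\<^sub>F h in at_right 0. h + h * B < d"
  proof -
    have "((\<lambda>h. h + h * B) \<longlongrightarrow> 0 + 0 * B) (at_right 0)"
      by (intro tendsto_intros)
    then show ?thesis
      using \<open>0 < d\<close> by (intro order_tendstoD(2)) auto
  qed
  show ?thesis
    using small_r[of c2 P2] small_r[of c3 P3] small_u eventually_at_right_less[of 0]
  proof eventually_elim
    case (elim h)
    show ?case
    proof (intro allI impI, elim conjE)
      fix t e2 e3 :: real
      assume t: "t \<in> {a..b}" "t + h \<in> {a..b}" and tc: "t + c2 * h \<in> D" "t + c3 * h \<in> D"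
        and e: "\<bar>e2\<bar> \<le> M" "\<bar>e3\<bar> \<le> M"
      have h: "0 < h" "0 \<le> h" using elim by auto
      define F where "F = f t (u t)"
      define k2 where
        "k2 = f (t + c2 * h) (u t * exp (- (e2 * (c2 * h)\<^sup>2)) + h * (a21 * F))"
      define k3 where
        "k3 = f (t + c3 * h) (u t * exp (- (e3 * (c3 * h)\<^sup>2)) + h * (a31 * F + a32 * k2))"
      have F: "\<bar>F\<bar> \<le> B"
        unfolding F_def using B t by blast
      have "\<bar>a21 * F\<bar> \<le> P2"
        unfolding P2_def abs_mult using F by (intro mult_left_mono) auto
      then have k2: "\<bar>k2 - F\<bar> < \<eta>"
        unfolding k2_def F_def
        using stage_argument_dist_le[OF h(2) e(1) U[OF t(1)], of "a21 * F" P2 t c2] elim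
        by (intro near t tc) (auto simp: r_def F_def)
      have "\<bar>a31 * F + a32 * k2\<bar> \<le> \<bar>a31\<bar> * \<bar>F\<bar> + \<bar>a32\<bar> * \<bar>k2\<bar>"
        by (metis abs_mult abs_triangle_ineq)
      also have "\<dots> \<le> P3"
        unfolding P3_def using F k2 by (intro add_mono mult_left_mono) auto
      finally have k3: "\<bar>k3 - F\<bar> < \<eta>"
        unfolding k3_def F_def
        using stage_argument_dist_le[OF h(2) e(2) U[OF t(1)], of "a31 * F + a32 * k2" P3 t c3] elim
        by (intro near t tc) (auto simp: r_def F_def)
      \<comment> \<open>Used at \<open>s = t + h\<close> for the increment of \<open>u\<close>, and again at the intermediate point found
          there, to see that the graph of \<open>u\<close> over that point is still close to \<open>(t, u t)\<close>.\<close>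
      have mvt: "\<exists>\<xi>. t < \<xi> \<and> \<xi> < s \<and> u s - u t = (s - t) * f \<xi> (u \<xi>)"
        if "t < s" "s \<le> t + h" for s
      proof -
        have sub: "{t..s} \<subseteq> {a..b}" using t that by auto
        have "(u has_derivative (\<lambda>z. f x (u x) * z)) (at x)" if "t < x" "x < s" for x
        proof -
          have "x \<in> interior {a..b}"
            using t \<open>s \<le> t + h\<close> that by (simp add: interior_atLeastAtMost_real)
          then have "at x within {a..b} = at x"
            by (rule at_within_interior)
          then show ?thesis
            using deriv[of x] sub that by (auto simp: has_field_derivative_def)
        qed
        from mvt[OF \<open>t < s\<close> continuous_on_subset[OF cont_u sub] this]
        show ?thesis by (metis mult.commute)
      qed
      obtain \<xi> where \<xi>: "t < \<xi>" "\<xi> < t + h" "u (t + h) - u t = h * f \<xi> (u \<xi>)"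
        using mvt[of "t + h"] h by auto
      obtain \<zeta> where \<zeta>: "t < \<zeta>" "\<zeta> < \<xi>" "u \<xi> - u t = (\<xi> - t) * f \<zeta> (u \<zeta>)"
        using mvt[of \<xi>] \<xi> by auto
      have "\<bar>u \<xi> - u t\<bar> = \<bar>\<xi> - t\<bar> * \<bar>f \<zeta> (u \<zeta>)\<bar>"
        unfolding \<zeta> abs_mult ..
      also have "\<dots> \<le> h * B"
        using \<xi> \<zeta> t by (intro mult_mono B) auto
      finally have "\<bar>u \<xi> - u t\<bar> \<le> h * B" .
      moreover have "dist (t, u t) (\<xi>, u \<xi>) \<le> \<bar>\<xi> - t\<bar> + \<bar>u \<xi> - u t\<bar>"
        unfolding dist_Pair_Pair
        by (rule order.trans[OF sqrt_sum_squares_le_sum_abs])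
          (simp add: dist_real_def abs_minus_commute)
      ultimately have "dist (t, u t) (\<xi>, u \<xi>) < d"
        using \<xi> elim by simp
      then have slope: "\<bar>f \<xi> (u \<xi>) - F\<bar> < \<eta>"
        unfolding F_def using \<xi> t D by (intro near) auto
      have "rbf_rk3_step f a21 a31 a32 b1 b2 b3 c2 c3 e2 e3 h t (u t) - u (t + h)
          = h * (b1 * F + b2 * k2 + b3 * k3 - f \<xi> (u \<xi>))"
        using \<xi>(3) by (simp add: rbf_rk3_step_def Let_def F_def k2_def k3_def algebra_simps)
      also have "b1 * F + b2 * k2 + b3 * k3 - f \<xi> (u \<xi>)
          = b2 * (k2 - F) + b3 * (k3 - F) - (f \<xi> (u \<xi>) - F)"
      proof -
        have "F = (b1 + b2 + b3) * F" by (simp add: b)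
        then show ?thesis by (simp add: algebra_simps)
      qed
      finally have eq: "rbf_rk3_step f a21 a31 a32 b1 b2 b3 c2 c3 e2 e3 h t (u t) - u (t + h)
          = h * (b2 * (k2 - F) + b3 * (k3 - F) - (f \<xi> (u \<xi>) - F))" .
      have "\<bar>b2 * (k2 - F)\<bar> \<le> \<bar>b2\<bar> * \<eta>" "\<bar>b3 * (k3 - F)\<bar> \<le> \<bar>b3\<bar> * \<eta>"
        unfolding abs_mult using k2 k3 by (auto intro!: mult_left_mono)
      moreover have "\<bar>b2\<bar> * \<eta> + \<bar>b3\<bar> * \<eta> + \<eta> \<le> \<epsilon>"
        using \<eta> by (simp add: algebra_simps flip: \<eta>(2))
      ultimately have "\<bar>b2 * (k2 - F) + b3 * (k3 - F) - (f \<xi> (u \<xi>) - F)\<bar> \<le> \<epsilon>"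
        using slope by linarith
      then show "\<bar>rbf_rk3_step f a21 a31 a32 b1 b2 b3 c2 c3 e2 e3 h t (u t) - u (t + h)\<bar> \<le> h * \<epsilon>"
        unfolding eq abs_mult using h by (simp add: mult_left_mono)
    qed
  qed
qed

section \<open>Convergence\<close>

theorem theorem4p2:
  fixes a b u0 L M :: real
    and f :: "real \<Rightarrow> real \<Rightarrow> real"
    and u :: "real \<Rightarrow> real"
    and a21 a31 a32 b1 b2 b3 c2 c3 :: real
    and e2 e3 :: "nat \<Rightarrow> nat \<Rightarrow> real"
    and D :: "real set"
  assumes "a < b"
    and "admissible_times a b c2 c3 D"
    and "continuous_on (D \<times> UNIV) (\<lambda>(t, x). f t x)"
    and "\<And>t x1 x2. t \<in> D \<Longrightarrow> \<bar>f t x1 - f t x2\<bar> \<le> L * \<bar>x1 - x2\<bar>"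
    and "\<And>t. t \<in> {a..b} \<Longrightarrow> (u has_real_derivative f t (u t)) (at t within {a..b})"
    and "u a = u0"
    and "b1 + b2 + b3 = 1"
    and "a21 = c2"
    and "a31 + a32 = c3"
    and "b2 * c2 + b3 * c3 = 1 / 2"
    and "b2 * c2\<^sup>2 + b3 * c3\<^sup>2 = 1 / 3"
    and "a32 * b3 * c2 = 1 / 6"
    and "\<And>N n. N \<ge> 1 \<Longrightarrow> n < N \<Longrightarrow> \<bar>e2 N n\<bar> \<le> M \<and> \<bar>e3 N n\<bar> \<le> M"
  shows "(\<lambda>N. rbf_rk3 f a21 a31 a32 b1 b2 b3 c2 c3 e2 e3 a b u0 N N) \<longlonglongrightarrow> u b"
proof -
  note adm = assms(2) and lip = assms(4) and eps = assms(13)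
  have D: "{a..b} \<subseteq> D"
    using adm unfolding admissible_times_def by blast
  have "\<bar>f a 1 - f a 0\<bar> \<le> L * \<bar>1 - 0\<bar>"
    using D \<open>a < b\<close> by (intro lip) auto
  then have L: "0 \<le> L" by simp
  let ?S = "rbf_rk3_step f a21 a31 a32 b1 b2 b3 c2 c3"
  define v where "v N n = rbf_rk3 f a21 a31 a32 b1 b2 b3 c2 c3 e2 e3 a b u0 N n" for N n
  obtain K where K: "0 \<le> K"
    and stable: "\<And>h t x y s2 s3. 0 \<le> h \<and> h \<le> 1 \<and> \<bar>s2\<bar> \<le> M \<and> \<bar>s3\<bar> \<le> M \<and>
       (\<forall>s\<in>{t, t + c2 * h, t + c3 * h}. \<forall>x y. \<bar>f s x - f s y\<bar> \<le> L * \<bar>x - y\<bar>) \<Longrightarrow>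
      \<bar>?S s2 s3 h t x - ?S s2 s3 h t y\<bar> \<le> (1 + h * K) * \<bar>x - y\<bar>"
    using rbf_rk3_step_stability[OF L, of M c2 c3 f a21 a31 a32 b1 b2 b3] by metis
  define A where "A = (b - a) * exp (K * (b - a))"
  have A: "0 < A"
    unfolding A_def using \<open>a < b\<close> by simp
  have h_lim: "filterlim (step_size a b) (at_right 0) sequentially"
  proof (rule tendsto_imp_filterlim_at_right)
    show "step_size a b \<longlonglongrightarrow> 0"
      unfolding step_size_def[abs_def] by (rule lim_const_over_n)
    show "\<forall>\<^sub>F N in sequentially. 0 < step_size a b N"
      using eventually_gt_at_top[of 0]
      by eventually_elim (use \<open>a < b\<close> in \<open>simp add: step_size_def\<close>)
  qed
  have "\<forall>\<^sub>F N in sequentially. \<bar>v N N - u b\<bar> < r" if "0 < r" for r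
  proof -
    \<comment> \<open>With this defect the final bound \<open>\<epsilon> * A\<close> is \<open>r / 2\<close>.\<close>
    define \<epsilon> where "\<epsilon> = r / (2 * A)"
    have \<epsilon>: "0 < \<epsilon>" "\<epsilon> * A < r"
      unfolding \<epsilon>_def using A \<open>0 < r\<close> by auto
    have "\<forall>\<^sub>F h in at_right (0::real). h < 1"
      by (rule eventually_at_right_real[THEN eventually_mono, of 0 1]) auto
    note small = eventually_compose_filterlim[OF this h_lim]
    have "\<forall>\<^sub>F h in at_right 0. \<forall>t s2 s3.
      t \<in> {a..b} \<and> t + h \<in> {a..b} \<and> t + c2 * h \<in> D \<and> t + c3 * h \<in> D \<and> \<bar>s2\<bar> \<le> M \<and> \<bar>s3\<bar> \<le> M \<longrightarrow>
      \<bar>?S s2 s3 h t (u t) - u (t + h)\<bar> \<le> h * \<epsilon>"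
      by (rule rbf_rk3_step_consistency[OF D assms(3) _ assms(7) \<epsilon>(1)]) (rule assms(5))
    note consistent = eventually_compose_filterlim[OF this h_lim]
    show ?thesis
      using small consistent eventually_ge_at_top[of 1]
    proof eventually_elim
      case (elim N)
      define h where "h = step_size a b N"
      define t where "t n = grid_point a b N n" for n
      have h: "0 < h" "real N * h = b - a"
        unfolding h_def step_size_def using \<open>a < b\<close> elim(3) by auto
      have t: "t n = a + real n * h" for n
        by (simp add: t_def grid_point_def h_def)
      have t_in: "t n \<in> {a..b}" if "n \<le> N" for n
      proof -
        have "real n * h \<le> real N * h"
          using that h(1) by (intro mult_right_mono) auto
        then show ?thesis using h by (simp add: t)
      qed
      have t_Suc: "t (Suc n) = t n + h" for n
        by (simp add: t algebra_simps)
      define E where "E n = \<bar>v N n - u (t n)\<bar>" for n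
      have "E N \<le> \<epsilon> * (real N * h) * exp (K * (real N * h))"
      proof (rule one_step_error_bound)
        show "E 0 = 0"
          using \<open>u a = u0\<close> by (simp add: E_def v_def t)
      next
        fix n assume n: "n < N"
        have D': "t n \<in> D" "t n + c2 * h \<in> D" "t n + c3 * h \<in> D"
          using adm elim(3) n t_in[of n] D unfolding admissible_times_def t_def h_def by auto
        have e: "\<bar>e2 N n\<bar> \<le> M" "\<bar>e3 N n\<bar> \<le> M"
          using eps elim(3) n by auto
        have "\<bar>?S (e2 N n) (e3 N n) h (t n) (v N n) - ?S (e2 N n) (e3 N n) h (t n) (u (t n))\<bar>
            \<le> (1 + h * K) * E n"
          unfolding E_def using h(1) elim(1) D' e lip by (intro stable) (auto simp: h_def)
        moreover have "\<bar>?S (e2 N n) (e3 N n) h (t n) (u (t n)) - u (t (Suc n))\<bar> \<le> h * \<epsilon>"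
          using elim(2) t_in[of n] t_in[of "Suc n"] D' e n unfolding t_Suc h_def[symmetric] by simp
        moreover have "v N (Suc n) = ?S (e2 N n) (e3 N n) h (t n) (v N n)"
          by (simp add: v_def h_def t_def)
        ultimately show "E (Suc n) \<le> (1 + h * K) * E n + h * \<epsilon>"
          unfolding E_def[of "Suc n"] by linarith
      qed (use h K \<epsilon> in auto)
      also have "\<dots> = \<epsilon> * A"
        by (simp add: h(2) A_def)
      finally show ?case
        using \<epsilon>(2) h(2) by (simp add: E_def t)
    qed
  qed
  then show ?thesis
    unfolding tendsto_iff dist_real_def v_def by blast
qed

end
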